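(* Let $\lambda$ be a partition with $r$ parts (zero parts allowed), with degree sequence $n_\lambda=(n_{\lambda,1},\dots,n_{\lambda,r})$, and let $m\ge3$ be an odd integer with $\gcd(m,\Delta(n_\lambda))=1$. Then the residues $n_{\lambda,i}\bmod m\in\{0,1,\dots,m-1\}$, $1\le i\le r$, are pairwise distinct, so they form (as a set) the degree sequence of a unique partition $\mu$ of length $r$. Furthermore $$\mathrm{He}_\lambda(x)\equiv x^{|\lambda|-|\mu|}\,\mathrm{He}_\mu(x)\pmod m,$$ i.e. corresponding coefficients of the two integer polynomials are congruent modulo $m$.
   Context: $\mathrm{He}_k(x)$ denotes the monic probabilists' Hermite polynomial of degree $k$ (solution of $y''-xy'+ky=0$). A partition $\lambda=(\lambda_1\ge\dots\ge\lambda_r\ge 0)$ may have zero parts; $|\lambda|=\sum\lambda_i$. Its degree sequence is $n_\lambda=(\lambda_r,\lambda_{r-1}+1,\dots,\lambda_1+r-1)$; conversely any set of $r$ distinct non-negative integers is the degree sequence of exactly one partition of length $r$. $\Delta(x_1,\dots,x_r)=\prod_{i<j}(x_j-x_i)$. The Wronskian Hermite polynomial is $\mathrm{He}_\lambda(x)=\mathrm{Wr}[\mathrm{He}_{n_1},\dots,\mathrm{He}_{n_r}]/\Delta(n_\lambda)$ with $n_\lambda=(n_1,\dots,n_r)$; it is monic of degree $|\lambda|$ with integer coefficients. *)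

theory Defs
  imports "Jordan_Normal_Form.Determinant" "HOL-Computational_Algebra.Polynomial"
    "HOL-Number_Theory.Cong"
begin

fun hermite :: "nat \<Rightarrow> int poly" where
  "hermite 0 = 1"
| "hermite (Suc 0) = [:0, 1:]"
| "hermite (Suc (Suc k)) = [:0, 1:] * hermite (Suc k) - smult (int (Suc k)) (hermite k)"

definition wronskian :: "int poly list \<Rightarrow> int poly" where
  "wronskian fs = det (mat (length fs) (length fs) (\<lambda>(i, j). (pderiv ^^ i) (fs ! j)))"

definition is_partition :: "nat list \<Rightarrow> bool" where
  "is_partition lam \<longleftrightarrow> sorted_wrt (\<ge>) lam"

definition degseq :: "nat list \<Rightarrow> nat list" where
  "degseq lam = map (\<lambda>i. lam ! (length lam - 1 - i) + i) [0..<length lam]"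

definition vandermonde :: "nat list \<Rightarrow> int" where
  "vandermonde ns = (\<Prod>(i, j) \<in> {(i, j). i < j \<and> j < length ns}. int (ns ! j) - int (ns ! i))"

text \<open>Wronskian Hermite polynomial He_lam = Wr[He_n1, ..., He_nr] / Delta(n_lam)
  (an exact division in Z[x]).\<close>
definition hermite_partition :: "nat list \<Rightarrow> int poly" where
  "hermite_partition lam =
     map_poly (\<lambda>c. c div vandermonde (degseq lam)) (wronskian (map hermite (degseq lam)))"

end

theory Submission
  imports Defs
begin

text \<open>
  For odd \<open>m\<close> the explicit coefficients give \<open>He\<^sub>m \<equiv> x\<^sup>m\<close> modulo \<open>m\<close>, and the three-term recurrence
  then gives \<open>He\<^sub>k\<^sub>+\<^sub>m \<equiv> x\<^sup>m He\<^sub>k\<close>. Since the derivative of \<open>x\<^bsup>mq\<^esup>\<close> vanishes modulo \<open>m\<close>, these powers can be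
  pulled out of the columns of the Wronskian, and \<open>\<Delta>(n\<^sub>\<lambda>)\<close>, a unit modulo \<open>m\<close>, is congruent to the
  Vandermonde product of the residues; sorting the residues changes both by the same sign.

  The division in the definition of \<open>He\<^sub>\<lambda>\<close> must be shown to be exact. More generally \<open>\<Delta>(n)\<close> divides
  \<open>det (P\<^sub>i He\<^bsub>n\<^sub>j\<^esub>)\<close> for arbitrary differential operators \<open>P\<^sub>i\<close> over \<open>\<int>[x]\<close>. As \<open>He\<^sub>n\<^sub>+\<^sub>a = (x - D)\<^sup>a He\<^sub>n\<close>,
  the smallest index may be shifted to \<open>0\<close>. Writing \<open>P\<^sub>i = c\<^sub>i + P'\<^sub>i D\<close>, the column of \<open>He\<^sub>0 = 1\<close> is
  \<open>(c\<^sub>i)\<close>, and subtracting its multiple by \<open>He\<^sub>n\<close> from the column of \<open>He\<^sub>n\<close> leaves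
  \<open>n P'\<^sub>i He\<^sub>n\<^sub>-\<^sub>1\<close>, so induction on the size applies to the minors.
\<close>

section \<open>Divisibility of Hermite determinants by the Vandermonde product\<close>

lemma pderiv_hermite: "pderiv (hermite (Suc n)) = smult (int (Suc n)) (hermite n)"
proof (induction n rule: hermite.induct)
  case (3 k)
  have "pderiv (hermite (Suc (Suc (Suc k)))) =
      hermite (Suc (Suc k)) + [:0, 1:] * smult (int (Suc (Suc k))) (hermite (Suc k))
       - smult (int (Suc (Suc k))) (smult (int (Suc k)) (hermite k))"
    using 3 by (subst hermite.simps(3)) (simp add: pderiv_mult pderiv_diff pderiv_smult pderiv_pCons del: hermite.simps)
  also have "\<dots> = hermite (Suc (Suc k)) + smult (int (Suc (Suc k))) (hermite (Suc (Suc k)))"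
    by (simp add: algebra_simps smult_diff_right smult_add_right)
  also have "\<dots> = smult (int (Suc (Suc (Suc k)))) (hermite (Suc (Suc k)))"
    using smult_add_left[of 1 "int (Suc (Suc k))" "hermite (Suc (Suc k))"]
    by (simp del: hermite.simps)
  finally show ?case .
qed (simp_all add: pderiv_pCons)

text \<open>The sequences \<open>\<lambda>n. P (He\<^sub>n)\<close>, where \<open>P\<close> is a differential operator with coefficients
  in \<open>\<int>[x]\<close>: the rule splits off the order-zero part of \<open>P = c + P' \<circ> D\<close>.
  At \<open>n = 0\<close> the value of \<open>v\<close> is multiplied by zero.\<close>
inductive hermite_operator :: "(nat \<Rightarrow> int poly) \<Rightarrow> bool" where
  zero: "hermite_operator (\<lambda>n. 0)"
| step: "hermite_operator v \<Longrightarrow> hermite_operator (\<lambda>n. c * hermite n + of_nat n * v (n - 1))"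

lemma hermite_operator_stepI:
  assumes "hermite_operator v" "\<And>n. w n = c * hermite n + of_nat n * v (n - 1)"
  shows "hermite_operator w"
proof -
  have "w = (\<lambda>n. c * hermite n + of_nat n * v (n - 1))" using assms(2) by auto
  then show ?thesis using hermite_operator.step[OF assms(1)] by simp
qed

text \<open>At \<open>n = 0\<close> the factor \<open>of_nat n\<close> vanishes and He_0 = 1, so the
  order-zero coefficient can only be \<open>v 0\<close>.\<close>

lemma hermite_operator_decomp:
  assumes "hermite_operator v"
  obtains v' where "hermite_operator v'" "\<And>n. v n = v 0 * hermite n + of_nat n * v' (n - 1)"
  using assms
proof cases
  case zero
  then show ?thesis by (intro that[of "\<lambda>n. 0"]) (auto intro: hermite_operator.zero)
next
  case (step v' c)
  then show ?thesis by (intro that[of v']) auto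
qed

lemma hermite_operator_add:
  "hermite_operator v \<Longrightarrow> hermite_operator w \<Longrightarrow> hermite_operator (\<lambda>n. v n + w n)"
proof (induction v arbitrary: w rule: hermite_operator.induct)
  case zero
  then show ?case by simp
next
  case (step v c)
  obtain w' where w': "hermite_operator w'" "\<And>n. w n = w 0 * hermite n + of_nat n * w' (n - 1)"
    using step.prems hermite_operator_decomp by blast
  show ?case
    by (rule hermite_operator_stepI[OF step.IH[OF w'(1)], of _ "c + w 0"])
       (subst w'(2), simp add: algebra_simps)
qed

lemma hermite_operator_hermite: "hermite_operator (\<lambda>n. c * hermite n)"
  by (rule hermite_operator_stepI[OF hermite_operator.zero, of _ c]) simp

text \<open>Since He_(n+1) = (x - D) He_n, the shift replaces the operator P by P composed with x -
  D.\<close>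

lemma hermite_operator_Suc:
  "hermite_operator v \<Longrightarrow> hermite_operator (\<lambda>n. v (Suc n))"
proof (induction rule: hermite_operator.induct)
  case zero
  show ?case by (rule hermite_operator.zero)
next
  case (step v c)
  have rec: "hermite (Suc n) = [:0, 1:] * hermite n - of_nat n * hermite (n - 1)" for n
    by (cases n) (simp_all add: of_nat_poly)
  have 1: "hermite_operator (\<lambda>n. (c * [:0, 1:]) * hermite n + of_nat n * ((- c) * hermite (n - 1)))"
    by (rule hermite_operator.step[of "\<lambda>n. (- c) * hermite n"]) (rule hermite_operator_hermite)
  have 2: "hermite_operator (\<lambda>n. 0 * hermite n + of_nat n * v (Suc (n - 1)))"
    using hermite_operator.step[OF step.IH, of 0] by simp
  \<comment> \<open>Here \<open>(n + 1) v n\<close> splits into \<open>v n\<close> and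
    \<open>n v n\<close>; writing the latter with \<open>Suc (n - 1)\<close> changes nothing, as
    both forms vanish at 0, and makes the induction hypothesis applicable.\<close>
  have 3: "(\<lambda>n. c * hermite (Suc n) + of_nat (Suc n) * v (Suc n - 1)) =
     (\<lambda>n. ((c * [:0, 1:]) * hermite n + of_nat n * ((- c) * hermite (n - 1))) +
          (v n + (0 * hermite n + of_nat n * v (Suc (n - 1)))))"
  proof
    fix n
    show "c * hermite (Suc n) + of_nat (Suc n) * v (Suc n - 1) =
      ((c * [:0, 1:]) * hermite n + of_nat n * ((- c) * hermite (n - 1))) +
          (v n + (0 * hermite n + of_nat n * v (Suc (n - 1))))"
      by (subst rec, cases n) (simp_all add: algebra_simps del: hermite.simps mult_pCons_left mult_pCons_right)
  qed
  show ?case unfolding 3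
    by (intro hermite_operator_add 1 2 step.hyps)
qed

lemma hermite_operator_shift:
  "hermite_operator v \<Longrightarrow> hermite_operator (\<lambda>n. v (n + a))"
  by (induction a) (auto dest: hermite_operator_Suc)

text \<open>D^(i+1) He_n = n D^i He_(n-1) is an instance of the step rule with
  \<open>c = 0\<close>.\<close>

lemma hermite_operator_pderiv: "hermite_operator (\<lambda>n. (pderiv ^^ i) (hermite n))"
proof (induction i)
  case 0
  then show ?case using hermite_operator_hermite[of 1] by simp
next
  case (Suc i)
  have "(pderiv ^^ i) (smult c p) = smult c ((pderiv ^^ i) p)" for c and p :: "int poly"
    by (induction i) (simp_all add: pderiv_smult)
  moreover have "(pderiv ^^ i) 0 = (0 :: int poly)" by (induction i) simp_all
  ultimately show ?case
    by (intro hermite_operator_stepI[OF Suc, of _ 0], case_tac n)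
       (simp_all add: funpow_Suc_right pderiv_hermite of_nat_poly pderiv_1
         del: hermite.simps(2,3) of_nat_Suc funpow.simps)
qed

section \<open>Determinants and the recursion for the Vandermonde product\<close>

lemma det_scale_cols:
  fixes f :: "nat \<Rightarrow> nat \<Rightarrow> 'a :: comm_ring_1"
  shows "det (mat r r (\<lambda>(i, j). d j * f i j)) = (\<Prod>j<r. d j) * det (mat r r (\<lambda>(i, j). f i j))"
proof -
  have *: "p j < r" if "p permutes {0..<r}" "j < r" for p j
    using that permutes_in_image[of p "{0..<r}" j] by auto
  show ?thesis
    by (subst (1 2) det_col[of _ r])
       (auto simp: * sum_distrib_left prod.distrib mult_ac intro!: sum.cong)
qed

lemma vandermonde_Cons:
  "vandermonde (n # ns) = (\<Prod>j<length ns. int (ns ! j) - int n) * vandermonde ns"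
proof -
  let ?P = "\<lambda>l. {(i, j). i < j \<and> j < l}"
  have fin: "finite (?P l)" for l :: nat
    by (rule finite_subset[of _ "{..<l} \<times> {..<l}"]) auto
  have split: "?P (Suc l) = (\<lambda>j. (0, Suc j)) ` {..<l} \<union> (\<lambda>(i, j). (Suc i, Suc j)) ` ?P l" for l
  proof (rule equalityI; rule subsetI)
    fix z assume "z \<in> ?P (Suc l)"
    then obtain i j where z: "z = (i, Suc j)" "i < Suc j" "j < l"
      by (cases z; cases "snd z") auto
    show "z \<in> (\<lambda>j. (0, Suc j)) ` {..<l} \<union> (\<lambda>(i, j). (Suc i, Suc j)) ` ?P l"
      using z by (cases i) force+
  qed auto
  show ?thesis unfolding vandermonde_def
    by (simp add: split, subst prod.union_disjoint)
       (use fin in \<open>auto simp: prod.reindex inj_on_def case_prod_unfold\<close>)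
qed

lemma vandermonde_diff:
  assumes "\<forall>k\<in>set ns. a \<le> k"
  shows "vandermonde (map (\<lambda>k. k - a) ns) = vandermonde ns"
  using assms unfolding vandermonde_def
  by (intro prod.cong) (auto simp: of_nat_diff)

text \<open>Arbitrary operators replace the derivatives because the rows of the minors in the
  induction are the remainder operators \<open>u i\<close>.\<close>

lemma vandermonde_dvd_det:
  assumes "sorted_wrt (<) ns" "\<And>i. i < length ns \<Longrightarrow> hermite_operator (v i)"
  shows "[:vandermonde ns:] dvd det (mat (length ns) (length ns) (\<lambda>(i, j). v i (ns ! j)))"
  using assms
proof (induction "length ns" arbitrary: ns v)
  case 0
  then show ?case by (simp add: vandermonde_def flip: one_pCons)
next
  case (Suc r)
  then obtain a ms where ns: "ns = a # ms" by (cases ns) auto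
  have r: "length ms = r" using Suc ns by simp
  have gt: "a < ms ! j" if "j < r" for j using Suc.prems(1) ns r that by auto
  define w where "w i n = v i (n + a)" for i n
  have w: "hermite_operator (w i)" if "i < Suc r" for i
    unfolding w_def using that Suc by (intro hermite_operator_shift) auto
  have "\<forall>i. \<exists>u. i < Suc r \<longrightarrow> hermite_operator u \<and>
      (\<forall>n. w i n = w i 0 * hermite n + of_nat n * u (n - 1))"
    using w hermite_operator_decomp by metis
  then obtain u where u: "\<And>i. i < Suc r \<Longrightarrow> hermite_operator (u i)"
    "\<And>i n. i < Suc r \<Longrightarrow> w i n = w i 0 * hermite n + of_nat n * u i (n - 1)"
    by metis
  \<comment> \<open>The remainder \<open>u i\<close> is taken at \<open>n - 1\<close> with
    \<open>n = ms ! j - a\<close>, hence \<open>Suc a\<close>; strict increase makes this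
    subtraction exact.\<close>
  define ks where "ks = map (\<lambda>k. k - Suc a) ms"
  have ks: "length ks = r" "sorted_wrt (<) ks" "vandermonde ks = vandermonde ms"
  proof -
    show "length ks = r" using r by (simp add: ks_def)
    show "vandermonde ks = vandermonde ms" unfolding ks_def
      using gt r by (intro vandermonde_diff) (auto simp: in_set_conv_nth Suc_le_eq)
    have "sorted_wrt (<) ms" using Suc.prems(1) ns by simp
    then show "sorted_wrt (<) ks" using gt r unfolding ks_def sorted_wrt_iff_nth_less
      by (auto simp: Suc_le_eq intro!: diff_less_mono)
  qed
  define A where "A = mat (Suc r) (Suc r) (\<lambda>(i, j). v i (ns ! j))"
  define B where "B = mat (Suc r) (Suc r)
     (\<lambda>(i, j). case j of 0 \<Rightarrow> w i 0 | Suc j \<Rightarrow> of_nat (ms ! j - a) * u i (ks ! j))"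
  \<comment> \<open>Unitriangular column operations: for \<open>j > 0\<close>, column
    \<open>j\<close> of \<open>B * U\<close> is column \<open>j\<close> of \<open>B\<close> plus
    \<open>hermite (ns ! j - a)\<close> times column 0.\<close>
  define U where "U = mat (Suc r) (Suc r)
     (\<lambda>(i, j). if i = j then 1 else if i = 0 then hermite (ns ! j - a) else 0)"
  have carr: "A \<in> carrier_mat (Suc r) (Suc r)" "B \<in> carrier_mat (Suc r) (Suc r)"
    "U \<in> carrier_mat (Suc r) (Suc r)" by (auto simp: A_def B_def U_def)
  have "A = B * U"
  proof (rule eq_matI)
    fix i j assume "i < dim_row (B * U)" "j < dim_col (B * U)"
    then have ij: "i < Suc r" "j < Suc r" using carr by auto
    have "(B * U) $$ (i, j) = (\<Sum>k<Suc r. B $$ (i, k) * U $$ (k, j))"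
      using ij carr by (simp add: scalar_prod_def lessThan_atLeast0)
    also have "\<dots> = B $$ (i, 0) * U $$ (0, j) + (\<Sum>k<r. B $$ (i, Suc k) * U $$ (Suc k, j))"
      by (rule sum.lessThan_Suc_shift)
    also have "\<dots> = A $$ (i, j)"
    proof (cases j)
      case 0
      then show ?thesis using ij by (simp add: A_def B_def U_def ns w_def)
    next
      case (Suc l)
      then have "(\<Sum>k<r. B $$ (i, Suc k) * U $$ (Suc k, j)) = (\<Sum>k<r. if k = l then B $$ (i, Suc k) else 0)"
        using ij by (intro sum.cong) (auto simp: U_def)
      also have "\<dots> = B $$ (i, j)" using Suc ij by simp
      finally show ?thesis using ij Suc gt[of l] u(2)[of i "ms ! l - a"] r
        by (simp add: A_def B_def U_def ns w_def ks_def)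
    qed
    finally show "A $$ (i, j) = (B * U) $$ (i, j)" by simp
  qed (use carr in auto)
  moreover have "det U = 1"
    using carr(3) by (subst det_upper_triangular[OF _ carr(3)])
       (auto simp: U_def upper_triangular_def prod_list_diag_prod)
  ultimately have "det A = det B" using det_mult[OF carr(2,3)] by simp
  also have "\<dots> = (\<Sum>i<Suc r. B $$ (i, 0) * cofactor B i 0)"
    by (rule laplace_expansion_column[OF carr(2)]) simp
  also have "[:vandermonde ns:] dvd \<dots>"
  proof (rule dvd_sum, rule dvd_mult)
    fix i assume "i \<in> {..<Suc r}"
    then have i: "i < Suc r" by simp
    \<comment> \<open>The column factors \<open>ms ! j - a\<close> left in the minor are exactly
      those that turn \<open>vandermonde ks\<close> into \<open>vandermonde ns\<close>.\<close>
    have del: "mat_delete B i 0 =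
        mat r r (\<lambda>(k, j). of_nat (ms ! j - a) * u (insert_index i k) (ks ! j))"
      using i by (intro eq_matI) (auto simp: mat_delete_def B_def insert_index_def)
    have "[:vandermonde ks:] dvd
        det (mat (length ks) (length ks) (\<lambda>(k, j). u (insert_index i k) (ks ! j)))"
      using ks u(1) by (intro Suc.hyps(1)) (auto simp: insert_index_def)
    moreover have "(\<Prod>j<r. of_nat (ms ! j - a)) = [:\<Prod>j<r. int (ms ! j) - int a:]"
      using gt by (induction r) (auto simp: of_nat_poly of_nat_diff less_imp_le)
    ultimately show "[:vandermonde ns:] dvd cofactor B i 0"
      unfolding cofactor_def del det_scale_cols ns vandermonde_Cons r
      by (metis (no_types, lifting) ks(1,3) dvd_mult mult_dvd_mono dvd_refl mult_to_poly)
  qed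
  finally show ?case using Suc.hyps(2) by (simp add: A_def)
qed

section \<open>Hermite polynomials modulo an odd number\<close>

lemma coeff_hermite_Suc_Suc:
  "coeff (hermite (Suc (Suc n))) j =
    (if j = 0 then 0 else coeff (hermite (Suc n)) (j - 1)) - int (Suc n) * coeff (hermite n) j"
  by (cases j) (simp_all del: of_nat_Suc)

lemma coeff_hermite_eq_0: "n < j \<or> odd (n + j) \<Longrightarrow> coeff (hermite n) j = 0"
proof (induction n arbitrary: j rule: hermite.induct)
  case (3 n)
  show ?case unfolding coeff_hermite_Suc_Suc
    using "3.IH"(1)[of "j - 1"] "3.IH"(2)[of j] "3.prems" by (cases j) auto
qed (auto simp: coeff_pCons odd_pos split: nat.splits)

text \<open>The formula (-1)^k n! / (2^k k! j!) with denominators cleared. In the recurrence the two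
  terms contribute the shares j and 2k of the factor n + 2 = j + 2k.\<close>

lemma coeff_hermite_fact:
  "n = j + 2 * k \<Longrightarrow> coeff (hermite n) j * (2 ^ k * fact k * fact j) = (- 1) ^ k * fact n"
proof (induction n arbitrary: j k rule: hermite.induct)
  case 2
  then have "j = 1" "k = 0" by presburger+
  then show ?case by simp
next
  case (3 n)
  have A: "j \<noteq> 0 \<Longrightarrow> coeff (hermite (Suc n)) (j - 1) * (2 ^ k * fact k * fact j) =
      int j * ((- 1) ^ k * fact (Suc n))"
  proof (cases j)
    case (Suc l)
    then have "coeff (hermite (Suc n)) l * (2 ^ k * fact k * fact l) = (- 1) ^ k * fact (Suc n)"
      using "3.IH"(1)[of l k] "3.prems" by (simp del: fact_Suc)
    then have "int j * (coeff (hermite (Suc n)) l * (2 ^ k * fact k * fact l)) =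
        int j * ((- 1) ^ k * fact (Suc n))" by simp
    then show ?thesis using Suc by (simp add: mult_ac del: hermite.simps fact_Suc)
       (simp add: fact_Suc mult_ac)
  qed simp
  \<comment> \<open>For \<open>k = 0\<close> the index \<open>j = n + 2\<close> exceeds the degree
    of He_n, so both sides vanish.\<close>
  have B: "int (Suc n) * coeff (hermite n) j * (2 ^ k * fact k * fact j) =
      - (2 * int k * ((- 1) ^ k * fact (Suc n)))"
  proof (cases k)
    case 0
    then show ?thesis using "3.prems" coeff_hermite_eq_0[of n j] by simp
  next
    case (Suc l)
    then have "coeff (hermite n) j * (2 ^ l * fact l * fact j) = (- 1) ^ l * fact n"
      using "3.IH"(2)[of j l] "3.prems" by simp
    then have "(int (Suc n) * 2 * int k) * (coeff (hermite n) j * (2 ^ l * fact l * fact j)) =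
      (int (Suc n) * 2 * int k) * ((- 1) ^ l * fact n)" by simp
    then show ?thesis using Suc by (simp add: algebra_simps)
  qed
  have "(if j = 0 then 0 else coeff (hermite (Suc n)) (j - 1)) * (2 ^ k * fact k * fact j)
      = int j * ((- 1) ^ k * fact (Suc n))" using A by simp
  then have "coeff (hermite (Suc (Suc n))) j * (2 ^ k * fact k * fact j) =
     (int j + 2 * int k) * ((- 1) ^ k * fact (Suc n))"
    unfolding coeff_hermite_Suc_Suc left_diff_distrib B by (simp add: algebra_simps)
  also have "int j + 2 * int k = int (Suc (Suc n))" using "3.prems" by simp
  finally show ?case by (simp add: algebra_simps)
qed simp

section \<open>Congruence of integer polynomials modulo \<open>m\<close>\<close>

definition pcong :: "int \<Rightarrow> int poly \<Rightarrow> int poly \<Rightarrow> bool" where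
  "pcong m p q \<longleftrightarrow> [:m:] dvd p - q"

lemma pcong_iff: "pcong m p q \<longleftrightarrow> (\<forall>k. [coeff p k = coeff q k] (mod m))"
  by (simp add: pcong_def const_poly_dvd_iff cong_iff_dvd_diff)

lemma pcong_refl [simp]: "pcong m p p"
  by (simp add: pcong_def)

lemma pcong_trans: "pcong m p q \<Longrightarrow> pcong m q s \<Longrightarrow> pcong m p s"
  unfolding pcong_iff using cong_trans by blast

lemma pcong_add: "pcong m p q \<Longrightarrow> pcong m p' q' \<Longrightarrow> pcong m (p + p') (q + q')"
  by (simp add: pcong_iff cong_add)

lemma pcong_diff: "pcong m p q \<Longrightarrow> pcong m p' q' \<Longrightarrow> pcong m (p - p') (q - q')"
  by (simp add: pcong_iff cong_diff)

lemma pcong_mult: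
  assumes "pcong m p q" "pcong m p' q'"
  shows "pcong m (p * p') (q * q')"
proof -
  have "p * p' - q * q' = (p - q) * p' + q * (p' - q')" by (simp add: algebra_simps)
  then show ?thesis using assms by (simp add: pcong_def)
qed

lemma pcong_smult: "pcong m p q \<Longrightarrow> [a = b] (mod m) \<Longrightarrow> pcong m (smult a p) (smult b q)"
  by (simp add: pcong_iff cong_mult)

lemma pcong_prod: "(\<And>i. i \<in> I \<Longrightarrow> pcong m (f i) (g i)) \<Longrightarrow> pcong m (prod f I) (prod g I)"
  by (induction I rule: infinite_finite_induct) (auto intro: pcong_mult)

lemma pcong_sum: "(\<And>i. i \<in> I \<Longrightarrow> pcong m (f i) (g i)) \<Longrightarrow> pcong m (sum f I) (sum g I)"
  by (induction I rule: infinite_finite_induct) (auto intro: pcong_add)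

lemma pcong_pderiv: "pcong m p q \<Longrightarrow> pcong m (pderiv p) (pderiv q)"
  by (simp add: pcong_iff coeff_pderiv cong_mult del: of_nat_Suc)

lemma pcong_smult_cancel:
  "pcong m (smult a p) (smult a q) \<Longrightarrow> coprime m a \<Longrightarrow> pcong m p q"
  by (simp add: pcong_iff cong_mult_lcancel coprime_commute)

lemma pcong_det:
  assumes "\<And>i j. i < r \<Longrightarrow> j < r \<Longrightarrow> pcong m (f i j) (g i j)"
  shows "pcong m (det (mat r r (\<lambda>(i, j). f i j))) (det (mat r r (\<lambda>(i, j). g i j)))"
proof -
  have *: "p j < r" if "p permutes {0..<r}" "j < r" for p j
    using that permutes_in_image[of p "{0..<r}" j] by auto
  show ?thesis
    by (subst (1 2) det_col[of _ r])
       (auto simp: * assms intro!: pcong_sum pcong_mult pcong_prod)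
qed

text \<open>Every lower nonzero coefficient, multiplied by 2^k, retains the factor m of m!, and 2^k
  is a unit modulo the odd m. Primality of m does not enter.\<close>

lemma pcong_hermite_odd:
  assumes "odd m"
  shows "pcong (int m) (hermite m) (monom 1 m)"
  unfolding pcong_iff
proof
  fix j
  consider "j = m" | "m < j \<or> odd (m + j)" | k where "m = j + 2 * k" "k > 0"
  proof (cases "m \<le> j \<or> odd (m + j)")
    case False
    then have "even (m - j)" "j < m" by auto
    then obtain k where "m - j = 2 * k" by (elim evenE)
    then show ?thesis using that(3)[of k] \<open>j < m\<close> by simp
  qed (use that(1,2) in fastforce)
  then show "[coeff (hermite m) j = coeff (monom 1 m) j] (mod int m)"
  proof cases
    case 1
    then show ?thesis using coeff_hermite_fact[of m m 0] by simp
  next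
    case 2
    then show ?thesis using coeff_hermite_eq_0[OF 2] by auto
  next
    case (3 k)
    obtain l where m: "m = Suc l" using assms by (cases m) auto
    \<comment> \<open>As k \<le> 2k - 1 and (2k - 1) + j = m - 1, the product k! j! already divides
      (m - 1)!.\<close>
    have "fact k dvd (fact (2 * k - 1) :: int)" using 3 by (intro fact_dvd) auto
    moreover have "fact (2 * k - 1) * fact j dvd (fact l :: int)"
    proof -
      have "l = (2 * k - 1) + j" using 3 m by simp
      then show ?thesis using fact_fact_dvd_fact[of "2 * k - 1" j] by simp
    qed
    ultimately have "fact k * fact j dvd (fact l :: int)"
      by (meson dvd_refl dvd_trans mult_dvd_mono)
    then obtain q where q: "(fact l :: int) = fact k * fact j * q" by auto
    have "(fact k * fact j) * (coeff (hermite m) j * 2 ^ k) =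
        (fact k * fact j) * ((- 1) ^ k * int m * q)"
      using coeff_hermite_fact[OF 3(1)] q m by (simp add: algebra_simps)
    then have "coeff (hermite m) j * 2 ^ k = (- 1) ^ k * int m * q"
      by (metis fact_nonzero mult_cancel_left no_zero_divisors)
    then have "int m dvd coeff (hermite m) j * 2 ^ k" by simp
    moreover have "coprime (int m) (2 ^ k)" using assms by simp
    ultimately have "int m dvd coeff (hermite m) j"
      by (simp add: coprime_dvd_mult_left_iff)
    then show ?thesis using 3 by (simp add: cong_0_iff)
  qed
qed

text \<open>Both sides obey the same recurrence modulo m, because k + 1 + m and k + 1 agree there;
  for \<open>k = 1\<close> the term m He_(m-1) drops out.\<close>

lemma pcong_hermite_add:
  assumes "odd m"
  shows "pcong (int m) (hermite (k + m)) (monom 1 m * hermite k)"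
proof (induction k rule: hermite.induct)
  case 1
  then show ?case using pcong_hermite_odd[OF assms] by simp
next
  case 2
  obtain l where m: "m = Suc l" using assms by (cases m) auto
  have "pcong (int m) ([:0, 1:] * hermite m - smult (int m) (hermite l)) ([:0, 1:] * monom 1 m - smult 0 (hermite l))"
    by (intro pcong_diff pcong_mult pcong_smult pcong_refl pcong_hermite_odd assms) (simp add: cong_0_iff)
  then show ?case using m by (simp add: mult.commute)
next
  case (3 k)
  have "pcong (int m) ([:0, 1:] * hermite (Suc k + m) - smult (int (Suc (k + m))) (hermite (k + m)))
     ([:0, 1:] * (monom 1 m * hermite (Suc k)) - smult (int (Suc k)) (monom 1 m * hermite k))"
    by (intro pcong_diff pcong_mult pcong_smult pcong_refl 3) (simp add: cong_iff_dvd_diff)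
  then show ?case by (simp add: algebra_simps smult_diff_right)
qed

lemma pcong_hermite_mod:
  assumes "odd m"
  shows "pcong (int m) (hermite n) (monom 1 (m * (n div m)) * hermite (n mod m))"
proof -
  have "pcong (int m) (hermite (k + m * q)) (monom 1 (m * q) * hermite k)" for k q
  proof (induction q)
    case (Suc q)
    have "pcong (int m) (hermite (k + m * q + m)) (monom 1 m * (monom 1 (m * q) * hermite k))"
      by (rule pcong_trans[OF pcong_hermite_add[OF assms] pcong_mult[OF pcong_refl Suc]])
    then show ?case by (simp add: mult_monom algebra_simps flip: mult.assoc)
  qed simp
  from this[of "n mod m" "n div m"] show ?thesis by simp
qed

text \<open>Powers of x^m have derivative divisible by m, so they act as constants under
  differentiation modulo m.\<close>

lemma pcong_pderiv_funpow_monom_mult: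
  assumes "pcong (int m) p (monom 1 (m * q) * f)"
  shows "pcong (int m) ((pderiv ^^ i) p) (monom 1 (m * q) * (pderiv ^^ i) f)"
proof (induction i)
  case (Suc i)
  let ?g = "(pderiv ^^ i) f"
  have "pderiv (monom 1 (m * q) * ?g) - monom 1 (m * q) * pderiv ?g = pderiv (monom 1 (m * q)) * ?g"
    by (simp add: pderiv_mult)
  moreover have "[:int m:] dvd pderiv (monom 1 (m * q))"
    by (simp add: pderiv_monom const_poly_dvd_iff)
  ultimately have "pcong (int m) (pderiv (monom 1 (m * q) * ?g)) (monom 1 (m * q) * pderiv ?g)"
    by (simp add: pcong_def)
  then show ?case using pcong_trans[OF pcong_pderiv[OF Suc]] by simp
qed (use assms in simp)

lemma pcong_wronskian_hermite_mod:
  assumes "odd m"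
  shows "pcong (int m) (wronskian (map hermite ns))
    (monom 1 (m * (\<Sum>n\<leftarrow>ns. n div m)) * wronskian (map hermite (map (\<lambda>n. n mod m) ns)))"
proof -
  let ?r = "length ns"
  let ?d = "\<lambda>j. monom 1 (m * (ns ! j div m)) :: int poly"
  have "pcong (int m) (det (mat ?r ?r (\<lambda>(i, j). (pderiv ^^ i) (hermite (ns ! j)))))
    (det (mat ?r ?r (\<lambda>(i, j). ?d j * (pderiv ^^ i) (hermite (ns ! j mod m)))))"
    by (intro pcong_det pcong_pderiv_funpow_monom_mult pcong_hermite_mod assms)
  moreover have "(\<Prod>j<?r. ?d j) = monom 1 (m * (\<Sum>n\<leftarrow>ns. n div m))"
  proof -
    have "(\<Prod>j<n. ?d j) = monom 1 (m * (\<Sum>j<n. ns ! j div m))" for n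
      by (induction n) (simp_all add: mult_monom algebra_simps)
    then show ?thesis by (simp add: sum_list_sum_nth atLeast0LessThan)
  qed
  moreover have "mat ?r ?r (\<lambda>(i, j). (pderiv ^^ i) (map hermite ns ! j)) =
     mat ?r ?r (\<lambda>(i, j). (pderiv ^^ i) (hermite (ns ! j)))" by (rule cong_mat) auto
  moreover have "mat ?r ?r (\<lambda>(i, j). (pderiv ^^ i) (map hermite (map (\<lambda>n. n mod m) ns) ! j)) =
     mat ?r ?r (\<lambda>(i, j). (pderiv ^^ i) (hermite (ns ! j mod m)))" by (rule cong_mat) auto
  ultimately show ?thesis unfolding wronskian_def det_scale_cols by simp
qed

section \<open>Reordering\<close>

lemma wronskian_swap:
  "wronskian (fs @ f # g # gs) = - wronskian (fs @ g # f # gs)"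
proof -
  let ?k = "length fs" and ?r = "length (fs @ g # f # gs)"
  let ?A = "mat ?r ?r (\<lambda>(i, j). (pderiv ^^ i) ((fs @ g # f # gs) ! j))"
  have "mat ?r ?r (\<lambda>(i, j). (pderiv ^^ i) ((fs @ f # g # gs) ! j)) = swapcols ?k (Suc ?k) ?A"
    by (rule eq_matI) (auto simp: nth_append nth_Cons')
  moreover have "det (swapcols ?k (Suc ?k) ?A) = - det ?A"
    by (rule det_swapcols[of _ ?r]) auto
  ultimately show ?thesis by (simp add: wronskian_def)
qed

text \<open>In the recursion over the head, each earlier entry contributes a product symmetric in
  the later ones; only the factor pairing \<open>a\<close> with \<open>b\<close> changes
  sign.\<close>

lemma vandermonde_swap:
  "vandermonde (ks @ a # b # ms) = - vandermonde (ks @ b # a # ms)"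
proof -
  have V: "vandermonde (k # xs) = (\<Prod>x\<leftarrow>xs. int x - int k) * vandermonde xs" for k xs
    by (simp add: vandermonde_Cons prod.list_conv_set_nth atLeast0LessThan)
  show ?thesis by (induction ks) (simp_all add: V algebra_simps)
qed

text \<open>One sign serves both quantities and every prefix \<open>ks\<close>; the prefix lets the
  induction pass beneath the head of the list.\<close>

lemma wronskian_vandermonde_insort:
  "\<exists>s \<in> {1, - 1}. \<forall>ks. vandermonde (ks @ insort x ys) = s * vandermonde (ks @ x # ys) \<and>
     wronskian (map h (ks @ insort x ys)) = smult s (wronskian (map h (ks @ x # ys)))"
proof (induction ys)
  case (Cons y ys)
  then obtain s where s: "s \<in> {1, - 1}"
    "\<And>ks. vandermonde (ks @ insort x ys) = s * vandermonde (ks @ x # ys)"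
    "\<And>ks. wronskian (map h (ks @ insort x ys)) = smult s (wronskian (map h (ks @ x # ys)))"
    by blast
  show ?case
  proof (cases "x \<le> y")
    case False
    \<comment> \<open>The hypothesis is used with \<open>y\<close> appended to the prefix;
      exchanging the neighbours \<open>x\<close> and \<open>y\<close> then adds one sign.\<close>
    have "vandermonde (ks @ y # insort x ys) = - s * vandermonde (ks @ x # y # ys) \<and>
      wronskian (map h (ks @ y # insort x ys)) = smult (- s) (wronskian (map h (ks @ x # y # ys)))" for ks
      using s(2,3)[of "ks @ [y]"] vandermonde_swap[of ks x y ys]
        wronskian_swap[of "map h ks" "h x" "h y" "map h ys"] by simp
    then show ?thesis using s(1) False by (intro bexI[of _ "- s"]) auto
  qed auto
qed auto

lemma wronskian_vandermonde_sort:
  "\<exists>s \<in> {1, - 1}. \<forall>ks. vandermonde (ks @ sort xs) = s * vandermonde (ks @ xs) \<and>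
     wronskian (map h (ks @ sort xs)) = smult s (wronskian (map h (ks @ xs)))"
proof (induction xs)
  case (Cons x xs)
  then obtain s where s: "s \<in> {1, - 1}"
    "\<And>ks. vandermonde (ks @ sort xs) = s * vandermonde (ks @ xs)"
    "\<And>ks. wronskian (map h (ks @ sort xs)) = smult s (wronskian (map h (ks @ xs)))"
    by blast
  obtain t where t: "t \<in> {1, - 1}"
    "\<And>ks. vandermonde (ks @ insort x (sort xs)) = t * vandermonde (ks @ x # sort xs)"
    "\<And>ks. wronskian (map h (ks @ insort x (sort xs))) = smult t (wronskian (map h (ks @ x # sort xs)))"
    using wronskian_vandermonde_insort[of x "sort xs" h] by blast
  have "vandermonde (ks @ sort (x # xs)) = (t * s) * vandermonde (ks @ x # xs) \<and>
     wronskian (map h (ks @ sort (x # xs))) = smult (t * s) (wronskian (map h (ks @ x # xs)))" for ks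
    using s(2,3)[of "ks @ [x]"] t(2,3)[of ks] by simp
  then show ?case using s(1) t(1) by (intro bexI[of _ "t * s"]) auto
qed auto

lemma cong_vandermonde_mod:
  "[vandermonde (map (\<lambda>n. n mod m) ns) = vandermonde ns] (mod int m)"
  unfolding vandermonde_def
  by (simp, rule cong_prod) (auto simp: cong_def zmod_int mod_diff_eq)

section \<open>Degree sequences\<close>

lemma length_degseq [simp]: "length (degseq lam) = length lam"
  by (simp add: degseq_def)

lemma sorted_degseq: "is_partition lam \<Longrightarrow> sorted_wrt (<) (degseq lam)"
proof -
  assume "is_partition lam"
  then have "lam ! (length lam - Suc i) \<le> lam ! (length lam - Suc j)" if "i < j" "j < length lam" for i j
    using that by (auto simp: is_partition_def sorted_wrt_iff_nth_less)
  then show ?thesis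
    by (fastforce simp: sorted_wrt_iff_nth_less degseq_def intro: add_le_less_mono)
qed

lemma degseq_inj:
  assumes "degseq lam = degseq mu"
  shows "lam = mu"
proof (rule nth_equalityI)
  show l: "length lam = length mu" using arg_cong[OF assms, of length] by simp
  fix i assume "i < length lam"
  then have "length mu - Suc i < length mu" "length mu - Suc (length mu - Suc i) = i" using l by auto
  then show "lam ! i = mu ! i"
    using arg_cong[OF assms, of "\<lambda>xs. xs ! (length mu - Suc i)"] l by (simp add: degseq_def)
qed

lemma degseq_surj:
  assumes "sorted_wrt (<) ns"
  obtains mu where "is_partition mu" "length mu = length ns" "degseq mu = ns"
proof
  let ?r = "length ns"
  let ?mu = "map (\<lambda>i. ns ! (?r - 1 - i) - (?r - 1 - i)) [0..<?r]"
  \<comment> \<open>Strict increase means growth by at least one per index; this makes the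
    subtractions in \<open>?mu\<close> exact and its parts weakly decreasing.\<close>
  have gap: "ns ! i + (j - i) \<le> ns ! j" if "i \<le> j" "j < ?r" for i j
    using that
  proof (induction j rule: dec_induct)
    case (step j)
    then have "ns ! j < ns ! Suc j" using assms by (simp add: sorted_wrt_iff_nth_less)
    then show ?case using step by simp
  qed simp
  show "length ?mu = ?r" by simp
  have ge: "i \<le> ns ! i" if "i < ?r" for i using gap[of 0 i] that by simp
  show "degseq ?mu = ns"
    by (rule nth_equalityI) (auto simp: degseq_def ge)
  show "is_partition ?mu" unfolding is_partition_def sorted_wrt_iff_nth_less
  proof (intro allI impI)
    fix i j assume ij: "i < j" "j < length ?mu"
    have "ns ! (?r - 1 - j) + ((?r - 1 - i) - (?r - 1 - j)) \<le> ns ! (?r - 1 - i)"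
      using ij by (intro gap) auto
    then have "ns ! (?r - 1 - j) - (?r - 1 - j) \<le> ns ! (?r - 1 - i) - (?r - 1 - i)"
      using ij by (auto simp: le_diff_conv)
    then show "?mu ! j \<le> ?mu ! i" using ij by simp
  qed
qed

text \<open>The correction depends only on the length, so it cancels when \<open>lam\<close> and
  \<open>mu\<close> are compared.\<close>

lemma sum_list_degseq: "sum_list (degseq lam) = sum_list lam + \<Sum>{..<length lam}"
proof -
  have "(\<Sum>i<length lam. lam ! (length lam - 1 - i)) = (\<Sum>i<length lam. lam ! i)"
    using sum.nat_diff_reindex[of "\<lambda>i. lam ! i" "length lam"] by simp
  then show ?thesis
    by (simp add: degseq_def sum_list_sum_nth sum.distrib atLeast0LessThan)
qed

text \<open>Divisibility of the determinant makes the coefficientwise \<open>div\<close>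
  exact.\<close>

lemma hermite_partition_wronskian:
  assumes "is_partition lam"
  shows "smult (vandermonde (degseq lam)) (hermite_partition lam) =
    wronskian (map hermite (degseq lam))"
proof -
  let ?r = "length lam" and ?ns = "degseq lam"
  have "[:vandermonde ?ns:] dvd det (mat ?r ?r (\<lambda>(i, j). (pderiv ^^ i) (hermite (?ns ! j))))"
    using vandermonde_dvd_det[OF sorted_degseq[OF assms] hermite_operator_pderiv] by simp
  also have "mat ?r ?r (\<lambda>(i, j). (pderiv ^^ i) (hermite (?ns ! j))) =
      mat ?r ?r (\<lambda>(i, j). (pderiv ^^ i) (map hermite ?ns ! j))"
    by (rule cong_mat) auto
  finally have "[:vandermonde ?ns:] dvd wronskian (map hermite ?ns)"
    by (simp add: wronskian_def)
  then show ?thesis unfolding hermite_partition_def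
    by (intro poly_eqI) (simp add: coeff_map_poly const_poly_dvd_iff)
qed

text \<open>A collision of residues would make m divide one factor of the product, contradicting
  coprimality.\<close>

lemma mod_neq_of_coprime_vandermonde:
  assumes "coprime (int m) (vandermonde ns)" "m \<noteq> 1" "i < length ns" "j < length ns" "i \<noteq> j"
  shows "ns ! i mod m \<noteq> ns ! j mod m"
proof -
  have *: False if "i < j" "j < length ns" "ns ! i mod m = ns ! j mod m" for i j
  proof -
    have fin: "finite {(i, j). i < j \<and> j < length ns}"
      by (rule finite_subset[of _ "{..<length ns} \<times> {..<length ns}"]) auto
    have "int m dvd int (ns ! j) - int (ns ! i)"
      using that(3) by (metis mod_eq_dvd_iff zmod_int)
    also have "\<dots> dvd vandermonde ns" unfolding vandermonde_def
      using dvd_prodI[OF fin, of "(i, j)" "\<lambda>(i, j). int (ns ! j) - int (ns ! i)"] that by simp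
    finally have "int m dvd 1" using assms(1) by (metis coprime_absorb_left int_dvd_int_iff)
    then show False using assms(2) by simp
  qed
  show ?thesis using assms *[of i j] *[of j i] by (metis linorder_neqE_nat)
qed

theorem mainTheorem5:
  fixes lam :: "nat list" and m :: nat
  assumes "is_partition lam"
    and "odd m" and "m \<ge> 3"
    and "coprime (int m) (vandermonde (degseq lam))"
  shows "(\<forall>i < length lam. \<forall>j < length lam. i \<noteq> j \<longrightarrow>
            degseq lam ! i mod m \<noteq> degseq lam ! j mod m)
       \<and> (\<exists>!mu. is_partition mu \<and> length mu = length lam \<and>
              set (degseq mu) = (\<lambda>k. k mod m) ` set (degseq lam))
       \<and> (\<forall>mu. is_partition mu \<and> length mu = length lam \<and>
              set (degseq mu) = (\<lambda>k. k mod m) ` set (degseq lam) \<longrightarrow>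
              sum_list mu \<le> sum_list lam \<and>
              (\<forall>k. [coeff (hermite_partition lam) k
                    = coeff (monom 1 (sum_list lam - sum_list mu) * hermite_partition mu) k] (mod int m)))"
proof -
  let ?ns = "degseq lam"
  define rs where "rs = map (\<lambda>n. n mod m) ?ns"
  have dist: "\<forall>i < length lam. \<forall>j < length lam. i \<noteq> j \<longrightarrow> ?ns ! i mod m \<noteq> ?ns ! j mod m"
    using mod_neq_of_coprime_vandermonde[OF assms(4)] assms(3) by simp
  then have drs: "distinct rs" by (simp add: rs_def distinct_conv_nth)
  have set_rs: "set rs = (\<lambda>k. k mod m) ` set ?ns" by (simp add: rs_def)
  \<comment> \<open>Degree sequences increase strictly, so the set of entries determines the list;
    this yields uniqueness of \<open>mu\<close>.\<close>
  have eq: "degseq mu = sort rs" if "is_partition mu" "set (degseq mu) = set rs" for mu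
    using that drs sorted_degseq[OF that(1)]
    by (intro sorted_distinct_set_unique) (auto simp: strict_sorted_iff)
  obtain mu0 where mu0: "is_partition mu0" "length mu0 = length (sort rs)" "degseq mu0 = sort rs"
    using degseq_surj[of "sort rs"] drs by (auto simp: strict_sorted_iff)
  have ex1: "\<exists>!mu. is_partition mu \<and> length mu = length lam \<and> set (degseq mu) = set rs"
  proof (rule ex1I[of _ mu0])
    show "is_partition mu0 \<and> length mu0 = length lam \<and> set (degseq mu0) = set rs"
      using mu0 by (simp add: rs_def)
    fix mu assume "is_partition mu \<and> length mu = length lam \<and> set (degseq mu) = set rs"
    then show "mu = mu0" using eq[of mu] mu0(3) by (metis degseq_inj)
  qed
  have main: "sum_list mu \<le> sum_list lam \<and>
      pcong (int m) (hermite_partition lam) (monom 1 (sum_list lam - sum_list mu) * hermite_partition mu)"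
    if mu: "is_partition mu" "length mu = length lam" "set (degseq mu) = set rs" for mu
  proof -
    let ?q = "\<Sum>n\<leftarrow>?ns. n div m"
    \<comment> \<open>Division with remainder, summed over the entries, identifies the exponent
      |lam| - |mu| as \<open>m * ?q\<close>.\<close>
    have "sum_list ?ns = m * ?q + sum_list rs"
    proof -
      have "sum_list xs = m * (\<Sum>n\<leftarrow>xs. n div m) + sum_list (map (\<lambda>n. n mod m) xs)" for xs
        by (induction xs) (simp_all add: algebra_simps)
      then show ?thesis unfolding rs_def .
    qed
    moreover have "sum_list (degseq mu) = sum_list rs"
      unfolding eq[OF mu(1,3)] by (simp flip: sum_mset_sum_list)
    ultimately have sum: "sum_list lam = m * ?q + sum_list mu"
      using mu(2) by (simp add: sum_list_degseq)
    obtain s where s: "s \<in> {1, - 1}" "vandermonde (degseq mu) = s * vandermonde rs"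
      "wronskian (map hermite (degseq mu)) = smult s (wronskian (map hermite rs))"
      using wronskian_vandermonde_sort[of rs hermite] eq[OF mu(1,3)] by (metis append_Nil)
    \<comment> \<open>The common sign cancels, so the identity for \<open>mu\<close> also holds for
      the residues in their original order.\<close>
    have "smult s (smult (vandermonde rs) (hermite_partition mu)) = smult s (wronskian (map hermite rs))"
      using hermite_partition_wronskian[OF mu(1)] s by simp
    then have W: "wronskian (map hermite rs) = smult (vandermonde rs) (hermite_partition mu)"
      using s(1) by auto
    have "pcong (int m) (smult (vandermonde ?ns) (hermite_partition lam))
        (smult (vandermonde rs) (monom 1 (m * ?q) * hermite_partition mu))"
      using pcong_wronskian_hermite_mod[OF assms(2), of ?ns]
      by (simp add: hermite_partition_wronskian[OF assms(1)] W flip: rs_def)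
    moreover have "pcong (int m) (smult (vandermonde rs) (monom 1 (m * ?q) * hermite_partition mu))
        (smult (vandermonde ?ns) (monom 1 (m * ?q) * hermite_partition mu))"
      unfolding rs_def by (intro pcong_smult pcong_refl cong_vandermonde_mod)
    \<comment> \<open>Both sides now carry the factor \<open>vandermonde ?ns\<close>, which is
      invertible modulo m.\<close>
    ultimately have "pcong (int m) (hermite_partition lam) (monom 1 (m * ?q) * hermite_partition mu)"
      using pcong_smult_cancel[OF _ assms(4)] pcong_trans by blast
    then show ?thesis using sum by simp
  qed
  show ?thesis
    using main by (intro conjI dist ex1[unfolded set_rs] allI impI) (auto simp: set_rs pcong_iff)
qed

end
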